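(* Let $q\ge1$ be an integer and let $F$ be a bipartite graph such that every component of $F$ is unicyclic or a tree, and $F$ contains at least one cycle. Then, as $n\to\infty$, $$\mathrm{ex}(n,F,q)=\left(\left\lfloor \frac{q^2}{2}\right\rfloor+o(1)\right)\binom{n}{2}=|U_{q,n}|+o(n^2).$$
   Context: All graphs are finite and simple. A unicyclic graph is a connected graph containing exactly one cycle. Let $n,q\ge 1$ be integers. For $\mathbf{x}\in\{0,1,\dots,q\}^n$ the support is $S_{\mathbf{x}}=\{i: x_i\neq 0\}$. Let $Q(n,2)=\{\mathbf{x}\in\{0,1,\dots,q\}^n: |S_{\mathbf{x}}|=2\}$; its elements are called $q$-edges, and a $q$-graph on $n$ vertices is a subset $H\subseteq Q(n,2)$. For a graph $F$ without isolated vertices and an integer $s\ge1$, a $q$-graph $H$ is an $s$-copy of $F$ if $|H|=|E(F)|$ and there is an isomorphism $\iota$ from $F$ to the graph with vertex set $\bigcup_{\mathbf{x}\in H}S_{\mathbf{x}}$ and edge set $\{S_{\mathbf{x}}:\mathbf{x}\in H\}$ such that, writing $\mathbf{x}^e$ for the unique element of $H$ with support $\iota(e)$, for all distinct $e,e'\in E(F)$ and $v\in e\cap e'$ we have $x^{e}_{\iota(v)}+x^{e'}_{\iota(v)}\ge s$. If $F$ has isolated vertices, $H\subseteq Q(n,2)$ is an $s$-copy of $F$ if $n\ge |V(F)|$ and $H$ is an $s$-copy of the subgraph of $F$ induced by its non-isolated vertices. A $q$-graph contains an $s$-copy of $F$ if some subset of it is an $s$-copy of $F$. $\mathrm{ex}(n,F,q)$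 is the maximum of $|H|$ over all $H\subseteq Q(n,2)$ containing no $(q+1)$-copy of $F$. The universal $q$-tree is $U_{q,n}=U^<\cup\bigcup_{1\le i<j\le n}U^{i,j,=}$, where $U^<=\{\mathbf{x}\in Q(n,2):\sum_i x_i<q+1\}$ and $U^{i,j,=}=\{\mathbf{x}\in Q(n,2): S_{\mathbf{x}}=\{i,j\},\ x_i<x_j,\ x_i+x_j=q+1\}$. *)

theory Defs
  imports Complex_Main "HOL-Library.Landau_Symbols"
begin

section \<open>Finite simple graphs\<close>

record 'a ugraph =
  verts :: "'a set"
  edges :: "'a set set"

definition simple_graph :: "'a ugraph \<Rightarrow> bool" where
  "simple_graph G \<longleftrightarrow> finite (verts G) \<and> (\<forall>e\<in>edges G. e \<subseteq> verts G \<and> card e = 2)"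

definition induced_subgraph :: "'a ugraph \<Rightarrow> 'a set \<Rightarrow> 'a ugraph" where
  "induced_subgraph G W = \<lparr>verts = W, edges = {e \<in> edges G. e \<subseteq> W}\<rparr>"

definition bipartite :: "'a ugraph \<Rightarrow> bool" where
  "bipartite G \<longleftrightarrow> (\<exists>A B. A \<union> B = verts G \<and> A \<inter> B = {} \<and>
     (\<forall>e\<in>edges G. \<exists>a\<in>A. \<exists>b\<in>B. e = {a, b}))"

definition reachable :: "'a ugraph \<Rightarrow> 'a rel" where
  "reachable G = {(u, v). u \<in> verts G \<and> v \<in> verts G \<and> (u, v) \<in> {(a, b). {a, b} \<in> edges G}\<^sup>*}"

definition connected_graph :: "'a ugraph \<Rightarrow> bool" where
  "connected_graph G \<longleftrightarrow> verts G \<noteq> {} \<and> (\<forall>u\<in>verts G. \<forall>v\<in>verts G. (u, v) \<in> reachable G)"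

definition components :: "'a ugraph \<Rightarrow> 'a ugraph set" where
  "components G = induced_subgraph G ` (verts G // reachable G)"

text \<open>A cycle of \<open>G\<close> is a subgraph of \<open>G\<close>; it is represented by its edge set, which determines it.
  In particular, rotating or reversing the vertex sequence \<open>vs\<close> gives the same cycle.\<close>
definition cycle_of :: "'a ugraph \<Rightarrow> 'a set set \<Rightarrow> bool" where
  "cycle_of G C \<longleftrightarrow> C \<subseteq> edges G \<and>
     (\<exists>vs. distinct vs \<and> length vs \<ge> 3 \<and>
        C = {{vs ! i, vs ! (Suc i mod length vs)} | i. i < length vs})"

definition tree :: "'a ugraph \<Rightarrow> bool" where
  "tree G \<longleftrightarrow> connected_graph G \<and> (\<nexists>C. cycle_of G C)"

definition unicyclic :: "'a ugraph \<Rightarrow> bool" where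
  "unicyclic G \<longleftrightarrow> connected_graph G \<and> (\<exists>!C. cycle_of G C)"

definition graph_iso :: "('a \<Rightarrow> 'b) \<Rightarrow> 'a ugraph \<Rightarrow> 'b ugraph \<Rightarrow> bool" where
  "graph_iso f G H \<longleftrightarrow> bij_betw f (verts G) (verts H) \<and>
     (\<forall>u\<in>verts G. \<forall>v\<in>verts G. {u, v} \<in> edges G \<longleftrightarrow> {f u, f v} \<in> edges H)"

definition non_isolated :: "'a ugraph \<Rightarrow> 'a set" where
  "non_isolated G = {v \<in> verts G. \<exists>e\<in>edges G. v \<in> e}"

section \<open>$q$-graphs\<close>

text \<open>The set \<open>{0,\<dots>,q}\<^sup>n\<close>, with coordinates indexed by \<open>{1..n}\<close>; a vector is a function
  that takes the value 0 at every index outside \<open>{1..n}\<close>.\<close>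
definition qvectors :: "nat \<Rightarrow> nat \<Rightarrow> (nat \<Rightarrow> nat) set" where
  "qvectors n q = {x. (\<forall>i\<in>{1..n}. x i \<in> {0..q}) \<and> (\<forall>i. i \<notin> {1..n} \<longrightarrow> x i = 0)}"

definition supp :: "(nat \<Rightarrow> nat) \<Rightarrow> nat set" where
  "supp x = {i. x i \<noteq> 0}"

definition qedges :: "nat \<Rightarrow> nat \<Rightarrow> (nat \<Rightarrow> nat) set" where
  "qedges n q = {x \<in> qvectors n q. card (supp x) = 2}"

definition support_graph :: "(nat \<Rightarrow> nat) set \<Rightarrow> nat ugraph" where
  "support_graph H = \<lparr>verts = (\<Union>x\<in>H. supp x), edges = supp ` H\<rparr>"

text \<open>For \<open>F\<close> without isolated vertices. If \<open>card H = card (edges F)\<close>, both finite, and \<open>\<iota>\<close> is an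
  isomorphism, then \<open>supp\<close> is injective on \<open>H\<close>, so the definite descriptions are well defined.\<close>
definition s_copy_core :: "nat \<Rightarrow> 'a ugraph \<Rightarrow> (nat \<Rightarrow> nat) set \<Rightarrow> bool" where
  "s_copy_core s F H \<longleftrightarrow> card H = card (edges F) \<and>
     (\<exists>\<iota>. graph_iso \<iota> F (support_graph H) \<and>
        (\<forall>e\<in>edges F. \<forall>e'\<in>edges F. e \<noteq> e' \<longrightarrow> (\<forall>v\<in>e \<inter> e'.
           (THE x. x \<in> H \<and> supp x = \<iota> ` e) (\<iota> v) +
           (THE x. x \<in> H \<and> supp x = \<iota> ` e') (\<iota> v) \<ge> s)))"

definition s_copy :: "nat \<Rightarrow> nat \<Rightarrow> nat \<Rightarrow> 'a ugraph \<Rightarrow> (nat \<Rightarrow> nat) set \<Rightarrow> bool" where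
  "s_copy n q s F H \<longleftrightarrow> H \<subseteq> qedges n q \<and>
     (if non_isolated F = verts F then s_copy_core s F H
      else n \<ge> card (verts F) \<and> s_copy_core s (induced_subgraph F (non_isolated F)) H)"

definition contains_s_copy :: "nat \<Rightarrow> nat \<Rightarrow> nat \<Rightarrow> 'a ugraph \<Rightarrow> (nat \<Rightarrow> nat) set \<Rightarrow> bool" where
  "contains_s_copy n q s F H \<longleftrightarrow> (\<exists>H'\<subseteq>H. s_copy n q s F H')"

definition ex :: "nat \<Rightarrow> 'a ugraph \<Rightarrow> nat \<Rightarrow> nat" where
  "ex n F q = Max {card H | H. H \<subseteq> qedges n q \<and> \<not> contains_s_copy n q (q + 1) F H}"

section \<open>The universal $q$-tree\<close>

definition U_less :: "nat \<Rightarrow> nat \<Rightarrow> (nat \<Rightarrow> nat) set" where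
  "U_less q n = {x \<in> qedges n q. (\<Sum>i=1..n. x i) < q + 1}"

definition U_eq :: "nat \<Rightarrow> nat \<Rightarrow> nat \<Rightarrow> nat \<Rightarrow> (nat \<Rightarrow> nat) set" where
  "U_eq q n i j = {x \<in> qedges n q. supp x = {i, j} \<and> x i < x j \<and> x i + x j = q + 1}"

definition universal_qtree :: "nat \<Rightarrow> nat \<Rightarrow> (nat \<Rightarrow> nat) set" where
  "universal_qtree q n = U_less q n \<union> (\<Union>(i, j) \<in> {(i, j). 1 \<le> i \<and> i < j \<and> j \<le> n}. U_eq q n i j)"

section \<open>Well-definedness of the extremal number\<close>

lemma finite_qedges: "finite (qedges n q)"
proof -
  have "qedges n q \<subseteq> {f. \<forall>i. (i \<in> {1..n} \<longrightarrow> f i \<in> {0..q}) \<and> (i \<notin> {1..n} \<longrightarrow> f i = 0)}"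
    by (auto simp: qedges_def qvectors_def)
  then show ?thesis
    by (rule finite_subset) (rule finite_set_of_finite_funs; simp)
qed

lemma not_contains_s_copy_empty:
  assumes "simple_graph F" "edges F \<noteq> {}"
  shows "\<not> contains_s_copy n q s F {}"
proof -
  have sub: "e \<subseteq> verts F" if "e \<in> edges F" for e
    using assms(1) that unfolding simple_graph_def by blast
  have "finite (Pow (verts F))"
    using assms(1) by (simp add: simple_graph_def)
  moreover have "edges F \<subseteq> Pow (verts F)"
    using sub by blast
  ultimately have "card (edges F) \<noteq> 0"
    using assms(2) finite_subset card_0_eq by metis
  moreover have "edges (induced_subgraph F (non_isolated F)) = edges F"
    using sub unfolding induced_subgraph_def non_isolated_def by (simp, blast)
  ultimately have "\<not> s_copy n q s F {}"
    by (simp add: s_copy_def s_copy_core_def)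
  then show ?thesis
    by (simp add: contains_s_copy_def)
qed

lemma ex_attained:
  assumes "simple_graph F" "edges F \<noteq> {}"
  shows "\<exists>H. H \<subseteq> qedges n q \<and> \<not> contains_s_copy n q (q + 1) F H \<and> card H = ex n F q"
    and "\<And>H. H \<subseteq> qedges n q \<Longrightarrow> \<not> contains_s_copy n q (q + 1) F H \<Longrightarrow> card H \<le> ex n F q"
proof -
  define P where "P H \<longleftrightarrow> H \<subseteq> qedges n q \<and> \<not> contains_s_copy n q (q + 1) F H" for H
  define S where "S = card ` Collect P"
  have "Collect P \<subseteq> Pow (qedges n q)"
    unfolding P_def by blast
  then have "finite (Collect P)"
    by (rule finite_subset) (simp add: finite_qedges)
  then have fin: "finite S"
    by (simp add: S_def)
  have "P {}"
    using not_contains_s_copy_empty[OF assms] by (simp add: P_def)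
  then have ne: "S \<noteq> {}"
    by (auto simp: S_def)
  have ex: "ex n F q = Max S"
    unfolding ex_def S_def P_def image_Collect by (rule refl)
  have "\<exists>H. P H \<and> card H = ex n F q"
    using Max_in[OF fin ne] unfolding ex by (auto simp: S_def)
  then show "\<exists>H. H \<subseteq> qedges n q \<and> \<not> contains_s_copy n q (q + 1) F H \<and> card H = ex n F q"
    unfolding P_def by (simp add: conj_assoc)
  show "card H \<le> ex n F q" if "H \<subseteq> qedges n q" "\<not> contains_s_copy n q (q + 1) F H" for H
    unfolding ex using Max_ge[OF fin] that by (simp add: S_def P_def)
qed

end

theory Submission
  imports Defs
begin

text \<open>
  Write \<open>K = q\<^sup>2 div 2\<close>, which is the integer part of \<open>q\<^sup>2 / 2\<close>. The universal $q$-tree has exactly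
  \<open>K\<close> edges on every pair of indices (\<open>card_universal_qtree\<close>) and contains no \<open>(q + 1)\<close>-copy of a
  graph with a cycle (\<open>universal_contains_no_copy\<close>): around a cycle all inequalities would have to
  be tight, and the indices would increase, or decrease, all the way around. This gives the lower
  bound.

  For the upper bound, consider a $q$-graph with at least \<open>(K + \<delta>) (n choose 2)\<close> edges. A positive
  fraction of the pairs \<open>i < j\<close> carries more than \<open>K\<close> edges, that is, more than half of the \<open>q\<^sup>2\<close>
  possible labels in \<open>{1..q} \<times> {1..q}\<close>. Any such set contains two labels \<open>s\<close> and \<open>s'\<close>, possibly
  equal, that are compatible at both ends, such that \<open>s\<close> is compatible with itself at the smaller
  index and \<open>s'\<close> with itself at the larger one (\<open>balanced_labels_exist\<close>). Here two coordinates
  are compatible if their sum is at least \<open>q + 1\<close>. By pigeonhole and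
  \<open>dense_relation_contains_biclique\<close> there are large sets \<open>A\<close> and \<open>B\<close> such that both labels are
  available on all pairs in \<open>A \<times> B\<close>.

  It remains to label the edges of \<open>F\<close>, embedded into \<open>A\<close> and \<open>B\<close>, by \<open>s\<close> and \<open>s'\<close> so that a
  vertex in \<open>A\<close> sees \<open>s'\<close> at most once and a vertex in \<open>B\<close> sees \<open>s\<close> at most once. Such a labelling
  is the same as a map that sends each edge to one of its ends injectively, and this exists
  because every component of \<open>F\<close> has at most one cycle (\<open>charge_edges_injectively\<close>).
\<close>

section \<open>Orienting pseudoforests\<close>

abbreviation conn :: "'a set set \<Rightarrow> 'a rel" where
  "conn E \<equiv> {(a, b). {a, b} \<in> E}\<^sup>*"

text \<open>Cycles are determined by the edges, so the vertex set only has to be some set that fits.\<close>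
abbreviation cycle_in :: "'a set set \<Rightarrow> 'a set set \<Rightarrow> bool" where
  "cycle_in E \<equiv> cycle_of \<lparr>verts = \<Union>E, edges = E\<rparr>"

lemma cycle_in_edges: "cycle_in (edges G) C \<longleftrightarrow> cycle_of G C"
  by (simp add: cycle_of_def)

lemma cycle_in_mono: "cycle_in E C \<Longrightarrow> E \<subseteq> E' \<Longrightarrow> cycle_in E' C"
  by (auto simp: cycle_of_def)

lemma conn_sym: "(x, y) \<in> conn E \<Longrightarrow> (y, x) \<in> conn E"
  by (rule symD[OF sym_rtrancl]) (auto simp: sym_def insert_commute)

lemma conn_mono: "E \<subseteq> E' \<Longrightarrow> (x, y) \<in> conn E \<Longrightarrow> (x, y) \<in> conn E'"
  by (rule rtrancl_mono[THEN subsetD]) auto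

text \<open>A walk becomes a path by cutting out the parts between two visits to the same vertex.\<close>
lemma conn_distinct_path:
  assumes "(u, v) \<in> conn E"
  shows "\<exists>vs. vs \<noteq> [] \<and> distinct vs \<and> hd vs = u \<and> last vs = v \<and> successively (\<lambda>a b. {a, b} \<in> E) vs"
  using assms
proof (induction rule: converse_rtrancl_induct)
  case base
  then show ?case by (intro exI[of _ "[v]"]) auto
next
  case (step y z)
  then obtain vs where vs: "vs \<noteq> []" "distinct vs" "hd vs = z" "last vs = v"
    "successively (\<lambda>a b. {a, b} \<in> E) vs" by blast
  show ?case
  proof (cases "y \<in> set vs")
    case True
    then obtain xs ys where "vs = xs @ y # ys" by (meson split_list)
    with vs show ?thesis
      by (intro exI[of _ "y # ys"]) (auto simp: successively_append_iff)
  next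
    case False
    with vs step.hyps show ?thesis
      by (intro exI[of _ "y # vs"]) (auto simp: successively_Cons)
  qed
qed

lemma cycle_through_edge:
  assumes "u \<noteq> v" "(u, v) \<in> conn E" "{u, v} \<notin> E"
  shows "\<exists>C. cycle_in (insert {u, v} E) C \<and> {u, v} \<in> C"
proof -
  obtain vs where vs: "vs \<noteq> []" "distinct vs" "hd vs = u" "last vs = v"
    "successively (\<lambda>a b. {a, b} \<in> E) vs"
    using conn_distinct_path[OF assms(2)] by blast
  define k where "k = length vs"
  have path: "{vs ! i, vs ! Suc i} \<in> E" if "Suc i < k" for i
    using vs(5) that by (auto simp: successively_conv_nth k_def)
  have ends: "vs ! 0 = u" "vs ! (k - 1) = v"
    using vs by (auto simp: k_def hd_conv_nth last_conv_nth)
  have "k \<noteq> 0" using vs by (simp add: k_def)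
  moreover have "k \<noteq> 1" using ends assms(1) by auto
  moreover have "k \<noteq> 2"
  proof
    assume "k = 2"
    then show False using path[of 0] ends assms(3) by simp
  qed
  ultimately have k: "k \<ge> 3" by linarith
  define C where "C = {{vs ! i, vs ! (Suc i mod k)} | i. i < k}"
  have closing: "{u, v} = {vs ! (k - 1), vs ! (Suc (k - 1) mod k)}"
    using ends k by auto
  then have "{u, v} \<in> C"
    unfolding C_def using k by (intro CollectI exI[of _ "k - 1"]) auto
  moreover have "C \<subseteq> insert {u, v} E"
  proof
    fix e assume "e \<in> C"
    then obtain i where i: "i < k" "e = {vs ! i, vs ! (Suc i mod k)}" by (auto simp: C_def)
    show "e \<in> insert {u, v} E"
    proof (cases "Suc i < k")
      case True
      with path i show ?thesis by auto
    next
      case False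
      then have "i = k - 1" using i by linarith
      with i closing show ?thesis by auto
    qed
  qed
  ultimately show ?thesis
    using vs k unfolding cycle_of_def C_def k_def by auto
qed

lemma cycle_connected:
  assumes "cycle_in E C" "x \<in> \<Union>C" "y \<in> \<Union>C"
  shows "(x, y) \<in> conn E"
proof -
  obtain vs where vs: "C \<subseteq> E" "length vs \<ge> 3" "C = {{vs ! i, vs ! (Suc i mod length vs)} | i. i < length vs}"
    using assms(1) by (auto simp: cycle_of_def)
  have step: "(vs ! 0, vs ! i) \<in> conn E" if "i < length vs" for i
    using that
  proof (induction i)
    case (Suc i)
    have "{vs ! i, vs ! (Suc i mod length vs)} \<in> C" 
      unfolding vs(3) using Suc.prems by (intro CollectI exI[of _ i]) auto
    then have "{vs ! i, vs ! Suc i} \<in> E" using vs(1) Suc.prems by auto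
    with Suc show ?case by (auto intro: rtrancl_into_rtrancl)
  qed simp
  have all: "(vs ! 0, z) \<in> conn E" if z: "z \<in> \<Union>C" for z
  proof -
    obtain i where "i < length vs" "z = vs ! i \<or> z = vs ! (Suc i mod length vs)"
      using z unfolding vs(3) by auto
    moreover have "Suc i mod length vs < length vs" using vs(2) by (intro mod_less_divisor) auto
    ultimately show ?thesis using step by metis
  qed
  show ?thesis by (rule rtrancl_trans[OF conn_sym[OF all[OF assms(2)]] all[OF assms(3)]])
qed

text \<open>An induction that deletes edges has to remember which vertices have already received an edge.
  Such a vertex uses up the component that it lies in, exactly as a cycle does. To treat both
  uniformly, a used vertex \<open>r\<close> is encoded as \<open>{{r}}\<close>, which has the type of a cycle
  (a set of edges) but is never one, since edges have two elements.\<close>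
definition anchors :: "'a set set \<Rightarrow> 'a set \<Rightarrow> 'a set set set" where
  "anchors E R = (\<lambda>r. {{r}}) ` R \<union> {C. cycle_in E C}"

text \<open>For \<open>R = {}\<close> this says that every component has at most one cycle.\<close>
definition separated :: "'a set set \<Rightarrow> 'a set \<Rightarrow> bool" where
  "separated E R \<longleftrightarrow> (\<forall>X\<in>anchors E R. \<forall>Y\<in>anchors E R. \<forall>x\<in>\<Union>X. \<forall>y\<in>\<Union>Y. (x, y) \<in> conn E \<longrightarrow> X = Y)"

lemma anchor_connected:
  assumes "X \<in> anchors E R" "x \<in> \<Union>X" "y \<in> \<Union>X"
  shows "(x, y) \<in> conn E"
proof (cases "cycle_in E X")
  case True
  then show ?thesis using assms(2,3) by (rule cycle_connected)
next
  case False
  then obtain r where "X = {{r}}" using assms(1) by (auto simp: anchors_def)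
  then show ?thesis using assms(2,3) by auto
qed

lemma anchors_mono: "E \<subseteq> E' \<Longrightarrow> anchors E R \<subseteq> anchors E' R"
  using cycle_in_mono by (auto simp: anchors_def)

text \<open>Induction on the edges, with the set \<open>R\<close> of used vertices varying. It suffices to find an end
  \<open>w\<close> of the last edge \<open>e = {u, v}\<close> whose component in the remaining graph has no anchor: then
  \<open>e\<close> is charged to \<open>w\<close>, and \<open>w\<close> is used from there on. If \<open>e\<close> closes a cycle, then this
  cycle was the only anchor of its component, and either end will do. If \<open>e\<close> is a bridge, then
  its deletion splits a component with at most one anchor, so one of the two sides has none.\<close>
lemma charge_edges_injectively:
  assumes "finite E" "\<forall>e\<in>E. card e = 2" "separated E R"
  shows "\<exists>\<phi>. inj_on \<phi> E \<and> (\<forall>e\<in>E. \<phi> e \<in> e - R)"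
  using assms
proof (induction E arbitrary: R rule: finite_induct)
  case empty
  show ?case by simp
next
  case (insert e E)
  obtain u v where e: "e = {u, v}" "u \<noteq> v"
    using insert.prems(1) by (auto simp: card_2_iff)
  define free where "free w \<longleftrightarrow> (\<forall>Y\<in>anchors E R. \<forall>y\<in>\<Union>Y. (w, y) \<notin> conn E)" for w
  have sep: "X = Y" if "X \<in> anchors (insert e E) R" "Y \<in> anchors (insert e E) R"
      "x \<in> \<Union>X" "y \<in> \<Union>Y" "(x, y) \<in> conn (insert e E)" for X Y x y
    using that insert.prems(2) unfolding separated_def by blast
  have sub: "anchors E R \<subseteq> anchors (insert e E) R" by (rule anchors_mono) auto
  have up: "(x, y) \<in> conn (insert e E)" if "(x, y) \<in> conn E" for x y
    using that by (rule conn_mono[rotated]) auto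
  have "\<exists>w\<in>e. free w"
  proof (cases "(u, v) \<in> conn E")
    case True
    then obtain C where C: "cycle_in (insert e E) C" "e \<in> C"
      using cycle_through_edge[of u v E] e insert.hyps(2) by auto
    have "free u"
      unfolding free_def
    proof (intro ballI notI)
      fix Y y assume Y: "Y \<in> anchors E R" "y \<in> \<Union>Y" "(u, y) \<in> conn E"
      have "C = Y"
        by (rule sep[of C Y u y]) (use C Y e sub up in \<open>auto simp: anchors_def\<close>)
      then have "e \<in> Y" using C by simp
      with Y(1) have "e \<in> E \<or> (\<exists>r. e = {r})"
        by (auto simp: anchors_def cycle_of_def)
      then show False using insert.hyps(2) e by auto
    qed
    then show ?thesis using e by auto
  next
    case False
    have "free u \<or> free v"
    proof (rule ccontr)
      assume "\<not> (free u \<or> free v)"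
      then obtain X x Y y where X: "X \<in> anchors E R" "x \<in> \<Union>X" "(u, x) \<in> conn E"
        and Y: "Y \<in> anchors E R" "y \<in> \<Union>Y" "(v, y) \<in> conn E"
        unfolding free_def by blast
      have "(u, v) \<in> conn (insert e E)" using e by auto
      then have "(x, y) \<in> conn (insert e E)"
        using up[OF conn_sym[OF X(3)]] up[OF Y(3)] by (meson rtrancl_trans)
      then have "X = Y" using sep X Y sub by blast
      then have "(x, y) \<in> conn E" using anchor_connected[OF Y(1), of x y] X(2) Y(2) by simp
      then have "(u, v) \<in> conn E" using X(3) conn_sym[OF Y(3)] by (meson rtrancl_trans)
      with False show False by simp
    qed
    then show ?thesis using e by auto
  qed
  then obtain w where w: "w \<in> e" "free w" by blast
  have "w \<notin> R" using w(2) by (auto simp: free_def anchors_def)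
  have anch: "anchors E (insert w R) = insert {{w}} (anchors E R)"
    by (auto simp: anchors_def)
  have "separated E (insert w R)"
    unfolding separated_def anch
  proof (intro ballI impI)
    fix X Y x y assume *: "X \<in> insert {{w}} (anchors E R)" "Y \<in> insert {{w}} (anchors E R)"
      "x \<in> \<Union>X" "y \<in> \<Union>Y" "(x, y) \<in> conn E"
    consider "X = {{w}}" "Y = {{w}}" | "X = {{w}}" "Y \<in> anchors E R"
      | "X \<in> anchors E R" "Y = {{w}}" | "X \<in> anchors E R" "Y \<in> anchors E R" using *(1,2) by blast
    then show "X = Y"
    proof cases
      case 2 then show ?thesis using * w(2) unfolding free_def by auto
    next
      case 3 then show ?thesis using * w(2) conn_sym[of x y E] unfolding free_def by auto
    next
      case 4
      then show ?thesis using sep[of X Y x y] sub up[OF *(5)] *(3,4) by blast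
    qed simp
  qed
  then obtain \<phi> where \<phi>: "inj_on \<phi> E" "\<forall>e\<in>E. \<phi> e \<in> e - insert w R"
    using insert.IH[of "insert w R"] insert.prems(1) by blast
  define \<psi> where "\<psi> = \<phi>(e := w)"
  have \<psi>: "\<psi> e = w" "\<And>e'. e' \<in> E \<Longrightarrow> \<psi> e' = \<phi> e'"
    using insert.hyps(2) by (auto simp: \<psi>_def)
  have "inj_on \<psi> E"
    using \<phi>(1) \<psi>(2) inj_on_cong by metis
  moreover have "w \<notin> \<psi> ` (E - {e})"
  proof
    assume "w \<in> \<psi> ` (E - {e})"
    then obtain e' where "e' \<in> E" "w = \<phi> e'" using \<psi>(2) by blast
    then show False using \<phi>(2) by blast
  qed
  ultimately have "inj_on \<psi> (insert e E)"
    using \<psi>(1) by (simp only: inj_on_insert) simp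
  moreover have "\<forall>e'\<in>insert e E. \<psi> e' \<in> e' - R"
    using \<phi>(2) \<psi> w(1) \<open>w \<notin> R\<close> by simp
  ultimately show ?case by blast
qed

lemma edges_connected_in_verts:
  assumes "simple_graph F" "(x, y) \<in> conn (edges F)" "x \<in> verts F"
  shows "(x, y) \<in> reachable F"
proof -
  have "y \<in> verts F"
    using assms(2,3)
  proof (induction rule: rtrancl_induct)
    case (step y z)
    then show ?case using assms(1) by (auto simp: simple_graph_def)
  qed
  with assms show ?thesis by (simp add: reachable_def)
qed

text \<open>Two cycles that are joined by a walk lie in the same component, which is unicyclic or a tree.\<close>
lemma pseudoforest_separated:
  assumes F: "simple_graph F" and comp: "\<forall>C\<in>components F. unicyclic C \<or> tree C"
  shows "separated (edges F) {}"
  unfolding separated_def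
proof (intro ballI impI)
  fix X Y x y
  assume XY: "X \<in> anchors (edges F) {}" "Y \<in> anchors (edges F) {}"
    and xy: "x \<in> \<Union>X" "y \<in> \<Union>Y" "(x, y) \<in> conn (edges F)"
  have cyc: "cycle_of F X" "cycle_of F Y"
    using XY by (auto simp: anchors_def cycle_in_edges)
  have "X \<subseteq> edges F" using cyc(1) by (simp add: cycle_of_def)
  then have xV: "x \<in> verts F"
    using xy(1) F unfolding simple_graph_def by blast
  define W where "W = reachable F `` {x}"
  define K where "K = induced_subgraph F W"
  have "K \<in> components F"
    unfolding components_def K_def W_def using xV by (auto simp: quotient_def)
  moreover have inK: "cycle_of K Z" if Z: "cycle_of F Z" "z \<in> \<Union>Z" "(x, z) \<in> conn (edges F)" for Z z
  proof -
    have "a \<in> W" if a: "a \<in> \<Union>Z" for a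
    proof -
      have "(z, a) \<in> conn (edges F)"
        using cycle_connected[of "edges F" Z z a] Z a by (simp add: cycle_in_edges)
      then have "(x, a) \<in> conn (edges F)" using Z(3) by (meson rtrancl_trans)
      then show ?thesis
        using edges_connected_in_verts[OF F] xV by (simp add: W_def)
    qed
    moreover have "Z \<subseteq> edges F" using Z(1) by (simp add: cycle_of_def)
    ultimately have "Z \<subseteq> edges K"
      unfolding K_def induced_subgraph_def by auto
    then show ?thesis using Z(1) by (simp add: cycle_of_def)
  qed
  have "cycle_of K X" "cycle_of K Y"
    using inK[OF cyc(1) xy(1)] inK[OF cyc(2) xy(2,3)] by auto
  ultimately show "X = Y"
    using comp unfolding unicyclic_def tree_def by blast
qed

section \<open>Labelled pairs of indices\<close>

definition index_pairs :: "nat \<Rightarrow> (nat \<times> nat) set" where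
  "index_pairs n = {(i, j). 1 \<le> i \<and> i < j \<and> j \<le> n}"

definition labels :: "nat \<Rightarrow> (nat \<times> nat) set" where
  "labels q = {1..q} \<times> {1..q}"

definition pair_vec :: "nat \<times> nat \<Rightarrow> nat \<times> nat \<Rightarrow> nat \<Rightarrow> nat" where
  "pair_vec p l = (\<lambda>k. if k = fst p then fst l else if k = snd p then snd l else 0)"

text \<open>A $q$-graph is viewed as assigning to each pair \<open>i < j\<close> a subset of \<open>{1..q} \<times> {1..q}\<close>. The size
  of the $q$-graph is the sum of the sizes of these subsets.\<close>
definition label_set :: "(nat \<Rightarrow> nat) set \<Rightarrow> nat \<Rightarrow> nat \<times> nat \<Rightarrow> (nat \<times> nat) set" where
  "label_set H q p = {l \<in> labels q. pair_vec p l \<in> H}"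

lemma finite_index_pairs [simp]: "finite (index_pairs n)"
  by (rule finite_subset[of _ "{1..n} \<times> {1..n}"]) (auto simp: index_pairs_def)

lemma finite_labels [simp]: "finite (labels q)" and card_labels: "card (labels q) = q\<^sup>2"
  by (auto simp: labels_def power2_eq_square)

lemma finite_label_set [simp]: "finite (label_set H q p)"
  by (simp add: label_set_def)

lemma card_label_set_le: "card (label_set H q p) \<le> q\<^sup>2"
  unfolding card_labels[symmetric] by (rule card_mono) (auto simp: label_set_def)

lemma card_index_pairs: "card (index_pairs n) = n choose 2"
proof (induction n)
  case 0
  have "index_pairs 0 = {}" by (auto simp: index_pairs_def)
  then show ?case by simp
next
  case (Suc n)
  have "index_pairs (Suc n) = index_pairs n \<union> (\<lambda>i. (i, Suc n)) ` {1..n}"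
    by (auto simp: index_pairs_def)
  moreover have "index_pairs n \<inter> (\<lambda>i. (i, Suc n)) ` {1..n} = {}"
    by (auto simp: index_pairs_def)
  moreover have "card ((\<lambda>i. (i, Suc n)) ` {1..n}) = n"
    by (subst card_image) (auto simp: inj_on_def)
  ultimately have "card (index_pairs (Suc n)) = card (index_pairs n) + n"
    by (simp add: card_Un_disjoint)
  then show ?case using Suc by (simp add: numeral_2_eq_2)
qed

lemma supp_pair_vec:
  assumes "p \<in> index_pairs n" "l \<in> labels q"
  shows "supp (pair_vec p l) = {fst p, snd p}"
  using assms by (auto simp: supp_def pair_vec_def index_pairs_def labels_def)

lemma inj_pair_vec: "inj_on (\<lambda>(p, l). pair_vec p l) (index_pairs n \<times> labels q)"
proof (rule inj_onI)
  fix P P'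
  assume P: "P \<in> index_pairs n \<times> labels q" "P' \<in> index_pairs n \<times> labels q"
    and eq: "(\<lambda>(p, l). pair_vec p l) P = (\<lambda>(p, l). pair_vec p l) P'"
  obtain i j c d i' j' c' d' where d: "P = ((i, j), c, d)" "P' = ((i', j'), c', d')"
    by (metis surj_pair)
  have p: "(i, j) \<in> index_pairs n" "(i', j') \<in> index_pairs n"
    and l: "(c, d) \<in> labels q" "(c', d') \<in> labels q"
    using P d by auto
  have eq: "pair_vec (i, j) (c, d) = pair_vec (i', j') (c', d')"
    using eq d by simp
  have "{i, j} = {i', j'}"
    using supp_pair_vec[OF p(1) l(1)] supp_pair_vec[OF p(2) l(2)] eq by simp
  then have ij: "i = i'" "j = j'" using p by (auto simp: index_pairs_def doubleton_eq_iff)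
  moreover have "c = c'" "d = d'"
    using fun_cong[OF eq, of i] fun_cong[OF eq, of j] p ij
    by (auto simp: pair_vec_def index_pairs_def)
  ultimately show "P = P'" using d by simp
qed

lemma qedges_eq: "qedges n q = (\<lambda>(p, l). pair_vec p l) ` (index_pairs n \<times> labels q)"
proof (intro equalityI subsetI)
  fix x assume x: "x \<in> qedges n q"
  then obtain a b where ab: "supp x = {a, b}" "a \<noteq> b"
    by (auto simp: qedges_def card_2_iff)
  define i j where "i = min a b" and "j = max a b"
  have ij: "supp x = {i, j}" "i < j"
    using ab by (auto simp: i_def j_def min_def max_def)
  have nz: "x k \<noteq> 0 \<longleftrightarrow> k = i \<or> k = j" for k
    using ij(1) by (auto simp: supp_def set_eq_iff)
  have rng: "k \<in> {1..n} \<and> x k \<in> {1..q}" if "k = i \<or> k = j" for k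
  proof -
    have "x k \<noteq> 0" using nz that by blast
    moreover from this have "k \<in> {1..n}"
      using x by (auto simp: qedges_def qvectors_def)
    moreover from this have "x k \<in> {0..q}"
      using x by (auto simp: qedges_def qvectors_def)
    ultimately show ?thesis by auto
  qed
  have "x = pair_vec (i, j) (x i, x j)"
    using nz by (auto simp: pair_vec_def fun_eq_iff)
  moreover have "(i, j) \<in> index_pairs n" "(x i, x j) \<in> labels q"
    using rng[of i] rng[of j] ij(2) by (auto simp: index_pairs_def labels_def)
  ultimately show "x \<in> (\<lambda>(p, l). pair_vec p l) ` (index_pairs n \<times> labels q)"
    by (intro image_eqI[of _ _ "((i, j), (x i, x j))"]) auto
next
  fix x assume "x \<in> (\<lambda>(p, l). pair_vec p l) ` (index_pairs n \<times> labels q)"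
  then obtain p l where pl: "x = pair_vec p l" "p \<in> index_pairs n" "l \<in> labels q"
    by auto
  have "card (supp x) = 2"
    using supp_pair_vec[OF pl(2,3)] pl by (auto simp: index_pairs_def)
  moreover have "x \<in> qvectors n q"
    using pl by (auto simp: qvectors_def pair_vec_def index_pairs_def labels_def)
  ultimately show "x \<in> qedges n q" by (simp add: qedges_def)
qed

lemma card_eq_sum_label_sets:
  assumes "H \<subseteq> qedges n q"
  shows "card H = (\<Sum>p\<in>index_pairs n. card (label_set H q p))"
proof -
  have "H = (\<lambda>(p, l). pair_vec p l) ` (SIGMA p:index_pairs n. label_set H q p)"
    using assms unfolding qedges_eq label_set_def by fastforce
  moreover have "inj_on (\<lambda>(p, l). pair_vec p l) (SIGMA p:index_pairs n. label_set H q p)"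
    by (rule inj_on_subset[OF inj_pair_vec[of n q]]) (auto simp: label_set_def)
  ultimately have "card H = card (SIGMA p:index_pairs n. label_set H q p)"
    using card_image by metis
  then show ?thesis by simp
qed

section \<open>Balanced pairs of labels\<close>

definition complement :: "nat \<Rightarrow> nat \<times> nat \<Rightarrow> nat \<times> nat" where
  "complement q l = (q + 1 - fst l, q + 1 - snd l)"

lemma complement_in_labels: "l \<in> labels q \<Longrightarrow> complement q l \<in> labels q"
  by (auto simp: labels_def complement_def)

lemma inj_complement: "inj_on (complement q) (labels q)"
  by (auto simp: inj_on_def labels_def complement_def)

lemma complement_free_card_le:
  assumes "S \<subseteq> labels q" "\<And>l. l \<in> S \<Longrightarrow> complement q l \<notin> S"
  shows "2 * card S \<le> q\<^sup>2"
proof -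
  have "finite S" using assms(1) by (rule finite_subset) simp
  have "card (S \<union> complement q ` S) = card S + card (complement q ` S)"
    by (rule card_Un_disjoint) (use assms(2) \<open>finite S\<close> in blast)+
  also have "card (complement q ` S) = card S"
    by (rule card_image) (rule inj_on_subset[OF inj_complement assms(1)])
  finally have "2 * card S = card (S \<union> complement q ` S)" by simp
  also have "\<dots> \<le> card (labels q)"
    using assms(1) complement_in_labels[of _ q] by (intro card_mono) auto
  finally show ?thesis by (simp add: card_labels)
qed

text \<open>The condition under which pseudoforests can be labelled. Between two classes \<open>A\<close> and \<open>B\<close>,
  suppose that every edge is labelled \<open>s\<close> or \<open>s'\<close>. Then the coordinates at a vertex in \<open>A\<close> are
  compatible if at most one of its edges is labelled \<open>s'\<close>, and those at a vertex in \<open>B\<close> if at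
  most one of its edges is labelled \<open>s\<close>.\<close>
definition balanced :: "nat \<Rightarrow> nat \<times> nat \<Rightarrow> nat \<times> nat \<Rightarrow> bool" where
  "balanced q s s' \<longleftrightarrow> fst s + fst s' \<ge> q + 1 \<and> snd s + snd s' \<ge> q + 1
     \<and> 2 * fst s \<ge> q + 1 \<and> 2 * snd s' \<ge> q + 1"

text \<open>More than half of all labels include a label \<open>(a, b)\<close> together with its complement
  \<open>(q + 1 - a, q + 1 - b)\<close>; for odd \<open>q\<close> the two may coincide. If one coordinate of \<open>(a, b)\<close> is at
  least and the other at most \<open>(q + 1) / 2\<close>, the two labels are balanced in one of the two orders.
  Otherwise one of them has both coordinates at least \<open>(q + 1) / 2\<close> and is balanced with itself.\<close>
lemma balanced_labels_exist:
  assumes "S \<subseteq> labels q" "card S > q\<^sup>2 div 2"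
  shows "\<exists>s\<in>S. \<exists>s'\<in>S. balanced q s s'"
proof -
  have "\<not> 2 * card S \<le> q\<^sup>2" using assms(2) by linarith
  then obtain l where l: "l \<in> S" "complement q l \<in> S"
    using complement_free_card_le[OF assms(1)] by blast
  obtain a b where ab: "l = (a, b)" by force
  have le: "a \<le> q" "b \<le> q" using l(1) assms(1) ab by (auto simp: labels_def)
  define t where "t = complement q l"
  have t: "fst t = q + 1 - a" "snd t = q + 1 - b" by (auto simp: t_def complement_def ab)
  have "balanced q l t \<or> balanced q t l \<or> balanced q l l \<or> balanced q t t"
    unfolding balanced_def using t ab le by auto
  then show ?thesis using l by (auto simp: t_def)
qed

section \<open>Complete bipartite subgraphs of dense relations\<close>

text \<open>This bound, of Markov type, turns a large average into many large values.\<close>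
lemma sum_le_count_above_threshold:
  fixes f :: "'b \<Rightarrow> real"
  assumes "finite Z" "\<And>z. z \<in> Z \<Longrightarrow> f z \<le> M" "\<tau> \<ge> 0"
  shows "sum f Z \<le> M * real (card {z \<in> Z. f z > \<tau>}) + \<tau> * real (card Z)"
proof -
  have "sum f Z = sum f {z \<in> Z. f z > \<tau>} + sum f {z \<in> Z. \<not> f z > \<tau>}"
    using assms(1) by (subst sum.union_disjoint[symmetric]) (auto intro!: sum.cong)
  also have "sum f {z \<in> Z. f z > \<tau>} \<le> of_nat (card {z \<in> Z. f z > \<tau>}) * M"
    by (rule sum_bounded_above) (use assms in auto)
  also have "sum f {z \<in> Z. \<not> f z > \<tau>} \<le> of_nat (card {z \<in> Z. \<not> f z > \<tau>}) * \<tau>"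
    by (rule sum_bounded_above) auto
  also have "\<dots> \<le> real (card Z) * \<tau>"
    by (intro mult_right_mono) (use assms in \<open>auto intro: card_mono\<close>)
  finally show ?thesis by (simp add: mult.commute)
qed

lemma pigeonhole_fibre:
  assumes "finite Y" "finite Z" "Z \<noteq> {}" "f ` Y \<subseteq> Z"
  shows "\<exists>z\<in>Z. card Y \<le> card Z * card {y \<in> Y. f y = z}"
proof -
  define M where "M = Max ((\<lambda>z. card {y \<in> Y. f y = z}) ` Z)"
  have "M \<in> (\<lambda>z. card {y \<in> Y. f y = z}) ` Z"
    unfolding M_def by (rule Max_in) (use assms in auto)
  then obtain z where z: "z \<in> Z" "M = card {y \<in> Y. f y = z}" by blast
  have "card Y = (\<Sum>z\<in>Z. card {y \<in> Y. f y = z})"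
    using sum.group[OF assms(1,2,4), of "\<lambda>_. 1::nat"] by simp
  also have "\<dots> \<le> of_nat (card Z) * M"
    by (rule sum_bounded_above) (use assms in \<open>auto simp: M_def\<close>)
  finally show ?thesis using z by auto
qed

text \<open>A qualitative form of the theorem of Kovari, Sos and Turan. Many elements of \<open>X\<close> have many
  neighbours; fix a set \<open>X0\<close> of \<open>m\<close> of them, where \<open>m\<close> depends on \<open>c\<close> and \<open>t\<close> only. On average an
  element of \<open>Y\<close> is related to a positive fraction of \<open>X0\<close>, so a positive fraction of \<open>Y\<close> is related
  to more than \<open>t\<close> elements of \<open>X0\<close>. As \<open>X0\<close> has only \<open>2 ^ m\<close> subsets, many elements of \<open>Y\<close> have
  the same neighbourhood in \<open>X0\<close>.\<close>
lemma dense_relation_contains_biclique: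
  fixes c :: real and t :: nat
  assumes "c > 0"
  shows "\<exists>N. \<forall>(X::'x set) (Y::'y set) R. finite X \<longrightarrow> finite Y \<longrightarrow> card X \<ge> N \<longrightarrow> card Y \<ge> N \<longrightarrow>
    R \<subseteq> X \<times> Y \<longrightarrow> real (card R) \<ge> c * card X * card Y \<longrightarrow>
    (\<exists>A B. A \<subseteq> X \<and> B \<subseteq> Y \<and> card A = t \<and> card B = t \<and> A \<times> B \<subseteq> R)"
proof -
  \<comment> \<open>\<open>m\<close> is chosen so that the average \<open>m * c / 2\<close> is at least twice the required \<open>t\<close>; the two terms
    of \<open>N\<close> provide \<open>m\<close> elements of large degree, and \<open>t\<close> elements in some neighbourhood class.\<close>
  define m where "m = nat \<lceil>4 * t / c\<rceil> + 1"
  have m: "real m * c \<ge> 4 * t"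
  proof -
    have "4 * t / c \<le> real m" unfolding m_def by linarith
    then show ?thesis using assms by (simp add: field_simps)
  qed
  define N where "N = nat \<lceil>2 * m / c + 4 * t * 2 ^ m / c\<rceil> + 1"
  have pos: "2 * m / c \<ge> 0" "4 * t * 2 ^ m / c \<ge> 0" using assms by auto
  have "2 * m / c + 4 * t * 2 ^ m / c \<le> real N"
    unfolding N_def by linarith
  then have "2 * m / c \<le> N" "4 * t * 2 ^ m / c \<le> N" using pos by linarith+
  then have N: "real m \<le> c / 2 * N" "t * 2 ^ m \<le> c / 4 * N" "N > 0"
    using assms by (auto simp: field_simps N_def)
  show ?thesis
  proof (intro exI[of _ N] allI impI)
    fix X :: "'x set" and Y :: "'y set" and R
    assume fin: "finite X" "finite Y" and XN: "card X \<ge> N" and YN: "card Y \<ge> N"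
      and R: "R \<subseteq> X \<times> Y" and dens: "real (card R) \<ge> c * card X * card Y"
    have Ypos: "real (card Y) > 0" using YN N(3) by simp
    define G where "G = {x \<in> X. real (card (R `` {x})) > c / 2 * card Y}"
    have "R = (SIGMA x:X. R `` {x})" using R by auto
    moreover have fibfin: "finite (R `` {x})" for x
      using R by (intro finite_subset[OF _ fin(2)]) auto
    ultimately have "card R = (\<Sum>x\<in>X. card (R `` {x}))"
      using card_SigmaI[OF fin(1), of "\<lambda>x. R `` {x}"] by simp
    then have "c * card X * card Y \<le> (\<Sum>x\<in>X. real (card (R `` {x})))"
      using dens by simp
    also have "\<dots> \<le> real (card Y) * real (card G) + c / 2 * card Y * real (card X)"
      unfolding G_def
    proof (rule sum_le_count_above_threshold)
      show "real (card (R `` {x})) \<le> real (card Y)" for x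
        using R by (simp, intro card_mono[OF fin(2)]) auto
    qed (use fin assms in auto)
    finally have "real (card Y) * (c / 2 * card X) \<le> real (card Y) * card G"
      by (simp add: algebra_simps)
    then have "c / 2 * card X \<le> card G" using Ypos by simp
    moreover have "c / 2 * N \<le> c / 2 * card X" using XN assms by simp
    ultimately have "m \<le> card G" using N(1) by linarith
    then obtain X0 where X0: "X0 \<subseteq> G" "card X0 = m"
      by (meson obtain_subset_with_card_n)
    have finX0: "finite X0" using X0 fin unfolding G_def
      by (metis (no_types, lifting) finite_subset mem_Collect_eq subsetI)
    define T where "T y = {x \<in> X0. (x, y) \<in> R}" for y
    define Y1 where "Y1 = {y \<in> Y. real (card (T y)) > real t}"
    have "(\<Sum>x\<in>X0. card (R `` {x})) = (\<Sum>x\<in>X0. card {y \<in> Y. (x, y) \<in> R})"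
      using R by (intro sum.cong refl arg_cong[where f = card]) auto
    also have "\<dots> = (\<Sum>y\<in>Y. card (T y))"
      unfolding T_def by (rule sum_multicount_gen) (use finX0 fin in auto)
    finally have count: "real (\<Sum>x\<in>X0. card (R `` {x})) = real (\<Sum>y\<in>Y. card (T y))"
      by simp
    have "m * (c / 2 * card Y) \<le> (\<Sum>x\<in>X0. real (card (R `` {x})))"
      using sum_bounded_below[of X0 "c / 2 * card Y" "\<lambda>x. real (card (R `` {x}))"] X0
      by (force simp: G_def)
    also have "\<dots> = (\<Sum>y\<in>Y. real (card (T y)))"
      using count by simp
    also have "\<dots> \<le> real m * card Y1 + real t * card Y"
      unfolding Y1_def
    proof (rule sum_le_count_above_threshold)
      show "real (card (T y)) \<le> real m" for y
        unfolding X0(2)[symmetric] T_def using finX0 by (simp, intro card_mono) auto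
    qed (use fin in auto)
    finally have "m * (c / 2 * card Y) \<le> real m * card Y1 + real t * card Y" .
    moreover have "real t * card Y \<le> m * c / 4 * card Y"
      by (intro mult_right_mono) (use m in auto)
    ultimately have "real m * (c / 4 * card Y) \<le> real m * card Y1"
      by (simp add: algebra_simps)
    then have "c / 4 * card Y \<le> card Y1" by (simp add: m_def)
    moreover have "c / 4 * N \<le> c / 4 * card Y" using YN assms by simp
    ultimately have "real (t * 2 ^ m) \<le> card Y1" using N(2) by simp
    then have Y1: "t * 2 ^ m \<le> card Y1" by linarith
    have finY1: "finite Y1" using fin by (simp add: Y1_def)
    obtain Z where Z: "Z \<subseteq> X0" "card Y1 \<le> 2 ^ m * card {y \<in> Y1. T y = Z}"
      using pigeonhole_fibre[of Y1 "Pow X0" T] finY1 finX0 X0(2)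
      by (auto simp: card_Pow T_def)
    define B0 where "B0 = {y \<in> Y1. T y = Z}"
    have "2 ^ m * t \<le> 2 ^ m * card B0" using Y1 Z(2) le_trans unfolding B0_def by (subst mult.commute) blast
    then have "t \<le> card B0" by simp
    then obtain B where B: "B \<subseteq> B0" "card B = t" by (meson obtain_subset_with_card_n)
    show "\<exists>A B. A \<subseteq> X \<and> B \<subseteq> Y \<and> card A = t \<and> card B = t \<and> A \<times> B \<subseteq> R"
    proof (cases "t = 0")
      case True
      then show ?thesis by (intro exI[of _ "{}"]) auto
    next
      case False
      then obtain y where "y \<in> B" using B by fastforce
      then have "t \<le> card Z" using B(1) by (auto simp: B0_def Y1_def)
      then obtain A where A: "A \<subseteq> Z" "card A = t" by (meson obtain_subset_with_card_n)
      have "A \<times> B \<subseteq> R" using A(1) B(1) by (auto simp: B0_def T_def)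
      moreover have "A \<subseteq> X" using A(1) Z(1) X0(1) by (auto simp: G_def)
      moreover have "B \<subseteq> Y" using B(1) by (auto simp: B0_def Y1_def)
      ultimately show ?thesis using A B by blast
    qed
  qed
qed

section \<open>Copies of pseudoforests in complete bipartite structures\<close>

lemma edges_induced_non_isolated:
  assumes "simple_graph F"
  shows "edges (induced_subgraph F (non_isolated F)) = edges F"
  using assms unfolding simple_graph_def induced_subgraph_def non_isolated_def by (simp, blast)

lemma s_copy_iff:
  assumes "simple_graph F"
  shows "s_copy n q s F H \<longleftrightarrow> H \<subseteq> qedges n q \<and> (non_isolated F = verts F \<or> card (verts F) \<le> n)
    \<and> s_copy_core s (induced_subgraph F (non_isolated F)) H"
proof -
  have "induced_subgraph F (non_isolated F) = F" if "non_isolated F = verts F"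
    using edges_induced_non_isolated[OF assms] that by (simp add: induced_subgraph_def)
  then show ?thesis by (auto simp: s_copy_def)
qed

text \<open>Map the two colour classes of \<open>F\<close> into \<open>A\<close> and \<open>B\<close>. An edge that is charged to its end in \<open>B\<close>
  gets the label \<open>s\<close>, an edge that is charged to its end in \<open>A\<close> gets \<open>s'\<close>. Since no vertex is
  charged twice, at most one edge at a vertex of \<open>A\<close> carries \<open>s'\<close>, and at most one edge at a
  vertex of \<open>B\<close> carries \<open>s\<close>; this is what balanced labels allow.\<close>
lemma biclique_contains_copy:
  fixes F :: "'a ugraph" and \<phi> :: "'a set \<Rightarrow> 'a"
  assumes F: "simple_graph F" and bip: "bipartite F"
    and \<phi>: "inj_on \<phi> (edges F)" "\<forall>e\<in>edges F. \<phi> e \<in> e"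
    and H: "H \<subseteq> qedges n q"
    and AB: "A \<subseteq> {1..n}" "B \<subseteq> {1..n}" "card A = card (verts F)" "card B = card (verts F)"
    and full: "\<And>a b l. a \<in> A \<Longrightarrow> b \<in> B \<Longrightarrow> l \<in> {s, s'} \<Longrightarrow> (a, b) \<in> index_pairs n \<and> l \<in> label_set H q (a, b)"
    and bal: "balanced q s s'"
  shows "contains_s_copy n q (q + 1) F H"
proof -
  obtain X Y where XY: "X \<union> Y = verts F" "X \<inter> Y = {}"
    and edges: "\<forall>e\<in>edges F. \<exists>x\<in>X. \<exists>y\<in>Y. e = {x, y}"
    using bip unfolding bipartite_def by (elim exE conjE)
  note edge = bspec[OF edges]
  have finV: "finite (verts F)" using F by (simp add: simple_graph_def)
  have fin: "finite X" "finite Y" "finite A" "finite B"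
    using finite_subset[of X, OF _ finV] finite_subset[of Y, OF _ finV] XY(1)
      finite_subset[OF AB(1)] finite_subset[OF AB(2)] by blast+
  have "card X \<le> card A" "card Y \<le> card B"
    unfolding AB(3,4) using XY(1) by (auto intro: card_mono[OF finV])
  then obtain f g where f: "inj_on f X" "f ` X \<subseteq> A" and g: "inj_on g Y" "g ` Y \<subseteq> B"
    using inj_on_iff_card_le[OF fin(1,3)] inj_on_iff_card_le[OF fin(2,4)] by blast
  have disj: "a \<noteq> b" "a < b" if "a \<in> A" "b \<in> B" for a b
    using full[OF that, of s] by (auto simp: index_pairs_def)
  define \<iota> where "\<iota> v = (if v \<in> X then f v else g v)" for v
  have \<iota>X: "\<iota> x \<in> A" if "x \<in> X" for x using f(2) that by (auto simp: \<iota>_def)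
  have \<iota>Y: "\<iota> y \<in> B" "\<iota> y \<notin> A" if "y \<in> Y" for y
  proof -
    show "\<iota> y \<in> B" using g(2) XY(2) that by (auto simp: \<iota>_def)
    then show "\<iota> y \<notin> A" using disj by blast
  qed
  have inj: "inj_on \<iota> (verts F)"
  proof (rule inj_onI)
    fix u v assume uv: "u \<in> verts F" "v \<in> verts F" "\<iota> u = \<iota> v"
    consider "u \<in> X" "v \<in> X" | "u \<in> X" "v \<in> Y" | "u \<in> Y" "v \<in> X" | "u \<in> Y" "v \<in> Y"
      using uv XY by blast
    then show "u = v"
    proof cases
      case 1 then show ?thesis using uv(3) f(1) by (simp add: \<iota>_def inj_on_def)
    next
      case 2 then show ?thesis using uv(3) \<iota>X[of u] \<iota>Y[of v] by simp
    next
      case 3 then show ?thesis using uv(3) \<iota>X[of v] \<iota>Y[of u] by simp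
    next
      case 4
      then have "u \<notin> X" "v \<notin> X" using XY(2) by blast+
      then show ?thesis using 4 uv(3) g(1) by (simp add: \<iota>_def inj_on_def)
    qed
  qed
  have sub: "e \<subseteq> verts F" if "e \<in> edges F" for e using F that by (simp add: simple_graph_def)
  have im_eq: "\<iota> ` e = \<iota> ` e' \<longleftrightarrow> e = e'" if "e \<subseteq> verts F" "e' \<subseteq> verts F" for e e'
    using inj_on_image_eq_iff[OF inj that] .
  define lab where "lab e = (if \<phi> e \<in> Y then s else s')" for e
  define w where "w e = (\<lambda>k. if k \<in> \<iota> ` e then if k \<in> A then fst (lab e) else snd (lab e) else 0)" for e
  have w: "w e \<in> H" "supp (w e) = \<iota> ` e" if e: "e \<in> edges F" for e
  proof -
    obtain x y where xy: "x \<in> X" "y \<in> Y" "e = {x, y}" using edge[OF e] by blast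
    have eq: "w e = pair_vec (\<iota> x, \<iota> y) (lab e)"
      using \<iota>X[OF xy(1)] \<iota>Y[OF xy(2)] by (auto simp: w_def pair_vec_def xy(3) fun_eq_iff)
    have l: "(\<iota> x, \<iota> y) \<in> index_pairs n" "lab e \<in> label_set H q (\<iota> x, \<iota> y)"
      using full[OF \<iota>X[OF xy(1)] \<iota>Y(1)[OF xy(2)], of "lab e"] by (auto simp: lab_def)
    then show "w e \<in> H" by (simp add: eq label_set_def)
    show "supp (w e) = \<iota> ` e"
      using l supp_pair_vec[OF l(1), of "lab e" q] unfolding eq by (simp add: label_set_def xy(3))
  qed
  define H' where "H' = w ` edges F"
  have the_w: "(THE x. x \<in> H' \<and> supp x = \<iota> ` e) = w e" if e: "e \<in> edges F" for e
  proof (rule the_equality)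
    show "w e \<in> H' \<and> supp (w e) = \<iota> ` e" using w(2)[OF e] e by (simp add: H'_def)
    fix x assume "x \<in> H' \<and> supp x = \<iota> ` e"
    then obtain e' where e': "e' \<in> edges F" "x = w e'" and "supp (w e') = \<iota> ` e"
      unfolding H'_def by blast
    then have "\<iota> ` e' = \<iota> ` e" using w(2)[OF e'(1)] by simp
    then show "x = w e" using im_eq[OF sub[OF e'(1)] sub[OF e]] e'(2) by simp
  qed
  have inj_w: "inj_on w (edges F)"
    by (rule inj_onI) (metis w(2) im_eq sub)
  have sum_ge: "w e (\<iota> v) + w e' (\<iota> v) \<ge> q + 1"
    if e: "e \<in> edges F" "e' \<in> edges F" "e \<noteq> e'" and v: "v \<in> e \<inter> e'" for e e' v
  proof -
    have ne: "\<phi> e \<noteq> \<phi> e'" using \<phi>(1) e by (auto dest: inj_onD)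
    have other: "\<phi> d = v \<or> (\<phi> d \<in> Y \<longleftrightarrow> v \<in> X)" if d: "d \<in> edges F" "v \<in> d" for d
    proof -
      obtain x y where xy: "x \<in> X" "y \<in> Y" "d = {x, y}" using edge[OF d(1)] by blast
      have "x \<notin> Y" "y \<notin> X" using xy XY(2) by blast+
      moreover have "\<phi> d = x \<or> \<phi> d = y" using \<phi>(2) d(1) xy(3) by blast
      ultimately show ?thesis using xy d(2) by auto
    qed
    have val: "w d (\<iota> v) = (if v \<in> X then fst (lab d) else snd (lab d))" if d: "d \<in> edges F" "v \<in> d" for d
    proof -
      have "v \<in> X \<or> v \<in> Y" using sub[OF d(1)] d(2) XY(1) by blast
      then have "\<iota> v \<in> A \<longleftrightarrow> v \<in> X" using \<iota>X[of v] \<iota>Y(2)[of v] by blast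
      then show ?thesis using d by (simp add: w_def)
    qed
    have "v \<in> e" "v \<in> e'" using v by auto
    note facts = val[OF e(1) this(1)] val[OF e(2) this(2)] other[OF e(1) this(1)] other[OF e(2) this(2)]
    show ?thesis
    proof (cases "v \<in> X")
      case True
      have "lab e = s \<or> lab e' = s" and "lab e \<in> {s, s'}" "lab e' \<in> {s, s'}"
        using facts(3,4) ne True by (auto simp: lab_def)
      then show ?thesis using facts(1,2) True bal by (auto simp: balanced_def)
    next
      case False
      have "v \<in> Y" using sub[OF e(1)] v XY(1) False by blast
      then have "lab e = s' \<or> lab e' = s'" and "lab e \<in> {s, s'}" "lab e' \<in> {s, s'}"
        using facts(3,4) ne False by (auto simp: lab_def)
      then show ?thesis using facts(1,2) False bal by (auto simp: balanced_def)
    qed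
  qed
  define F' where "F' = induced_subgraph F (non_isolated F)"
  have F': "edges F' = edges F" "verts F' = \<Union>(edges F)"
    using edges_induced_non_isolated[OF F] sub
    unfolding F'_def by (simp_all add: induced_subgraph_def non_isolated_def) blast
  have H'_supp: "supp ` H' = (\<lambda>e. \<iota> ` e) ` edges F"
    unfolding H'_def image_image using w(2) by (rule image_cong[OF refl])
  have "graph_iso \<iota> F' (support_graph H')"
    unfolding graph_iso_def
  proof (intro conjI ballI)
    have "(\<Union>x\<in>H'. supp x) = \<iota> ` verts F'"
      using H'_supp unfolding F' by (simp add: image_Union)
    then show "bij_betw \<iota> (verts F') (verts (support_graph H'))"
      using inj_on_subset[OF inj, of "verts F'"] sub
      by (auto simp: support_graph_def bij_betw_def F')
    fix u v assume "u \<in> verts F'" "v \<in> verts F'"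
    then have uv: "{u, v} \<subseteq> verts F" using sub unfolding F' by blast
    have "{u, v} \<in> edges F \<longleftrightarrow> \<iota> ` {u, v} \<in> (\<lambda>e. \<iota> ` e) ` edges F"
    proof
      assume "\<iota> ` {u, v} \<in> (\<lambda>e. \<iota> ` e) ` edges F"
      then obtain e where e: "e \<in> edges F" "\<iota> ` {u, v} = \<iota> ` e" by blast
      then have "{u, v} = e" using im_eq[OF uv sub[OF e(1)]] by simp
      then show "{u, v} \<in> edges F" using e(1) by simp
    qed (rule imageI)
    then show "{u, v} \<in> edges F' \<longleftrightarrow> {\<iota> u, \<iota> v} \<in> edges (support_graph H')"
      by (simp add: support_graph_def F' H'_supp)
  qed
  then have "s_copy_core (q + 1) F' H'"
    unfolding s_copy_core_def F' using card_image[OF inj_w] sum_ge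
    by (intro conjI exI[of _ \<iota>]) (auto simp: H'_def[symmetric] the_w)
  moreover have "card (verts F) \<le> n"
    using card_mono[OF finite_atLeastAtMost AB(1)] AB(3) by simp
  moreover have "H' \<subseteq> H" using w(1) by (auto simp: H'_def)
  ultimately show ?thesis
    unfolding contains_s_copy_def s_copy_iff[OF F] F'_def[symmetric] using H by blast
qed

section \<open>The universal q-tree\<close>

lemma sum_pair_vec:
  assumes "p \<in> index_pairs n"
  shows "(\<Sum>k=1..n. pair_vec p l k) = fst l + snd l"
proof -
  have "(\<Sum>k=1..n. pair_vec p l k) = (\<Sum>k\<in>{fst p, snd p}. pair_vec p l k)"
    by (rule sum.mono_neutral_right) (use assms in \<open>auto simp: pair_vec_def index_pairs_def\<close>)
  also have "\<dots> = fst l + snd l"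
    using assms by (auto simp: pair_vec_def index_pairs_def)
  finally show ?thesis .
qed

lemma universal_subset_qedges: "universal_qtree q n \<subseteq> qedges n q"
  by (auto simp: universal_qtree_def U_less_def U_eq_def)

definition universal_labels :: "nat \<Rightarrow> (nat \<times> nat) set" where
  "universal_labels q = {l \<in> labels q. fst l + snd l \<le> q \<or> fst l + snd l = q + 1 \<and> fst l < snd l}"

lemma label_set_universal:
  assumes p: "p \<in> index_pairs n"
  shows "label_set (universal_qtree q n) q p = universal_labels q"
proof -
  have "pair_vec p l \<in> universal_qtree q n \<longleftrightarrow> fst l + snd l \<le> q \<or> fst l + snd l = q + 1 \<and> fst l < snd l"
    if l: "l \<in> labels q" for l
  proof -
    obtain i j where ij: "p = (i, j)" "i < j" "1 \<le> i" "j \<le> n"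
      using p by (auto simp: index_pairs_def)
    have Q: "pair_vec p l \<in> qedges n q" unfolding qedges_eq using p l by force
    have vals: "pair_vec p l i = fst l" "pair_vec p l j = snd l"
      using ij by (auto simp: pair_vec_def)
    have less: "pair_vec p l \<in> U_less q n \<longleftrightarrow> fst l + snd l \<le> q"
      using Q sum_pair_vec[OF p, of l] by (auto simp: U_less_def)
    have "pair_vec p l \<in> U_eq q n a b \<longleftrightarrow> a = i \<and> b = j \<and> fst l < snd l \<and> fst l + snd l = q + 1"
      if "a < b" for a b
      using Q supp_pair_vec[OF p l] vals ij that by (auto simp: U_eq_def doubleton_eq_iff)
    then have "(\<exists>a b. 1 \<le> a \<and> a < b \<and> b \<le> n \<and> pair_vec p l \<in> U_eq q n a b)
        \<longleftrightarrow> fst l + snd l = q + 1 \<and> fst l < snd l"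
      using ij by blast
    then show ?thesis using less by (auto simp: universal_qtree_def)
  qed
  then show ?thesis by (auto simp: label_set_def universal_labels_def)
qed

text \<open>The complement maps these labels to the labels with a sum above \<open>q + 1\<close>, or with sum \<open>q + 1\<close> and
  the larger coordinate first. The two sets are disjoint and together contain every label except
  the fixed point of the complement, which exists for odd \<open>q\<close> only.\<close>
lemma card_universal_labels: "card (universal_labels q) = q\<^sup>2 div 2"
proof -
  let ?T = "universal_labels q"
  have T: "?T \<subseteq> labels q" by (auto simp: universal_labels_def)
  have "2 * card ?T \<le> q\<^sup>2"
    by (rule complement_free_card_le[OF T])
      (auto simp: universal_labels_def labels_def complement_def)
  moreover have "q\<^sup>2 \<le> 2 * card ?T + 1"
  proof -
    define M where "M = {l \<in> labels q. 2 * fst l = q + 1 \<and> fst l = snd l}"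
    have cover: "labels q \<subseteq> ?T \<union> complement q ` ?T \<union> M"
    proof
      fix l assume l: "l \<in> labels q"
      have inv: "complement q (complement q l) = l"
        using l by (auto simp: labels_def complement_def)
      have "l \<in> ?T \<or> complement q l \<in> ?T \<or> l \<in> M"
        using l complement_in_labels[OF l]
        by (auto simp: universal_labels_def M_def labels_def complement_def)
      then show "l \<in> ?T \<union> complement q ` ?T \<union> M" using inv by force
    qed
    have "finite ?T" using T by (rule finite_subset) simp
    have "M \<subseteq> {((q + 1) div 2, (q + 1) div 2)}" by (auto simp: M_def)
    then have M: "finite M" "card M \<le> 1"
      using card_mono[of "{((q + 1) div 2, (q + 1) div 2)}" M] finite_subset by auto
    have "q\<^sup>2 \<le> card (?T \<union> complement q ` ?T \<union> M)"
      unfolding card_labels[symmetric] using M \<open>finite ?T\<close> by (intro card_mono[OF _ cover]) auto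
    also have "\<dots> \<le> card ?T + card (complement q ` ?T) + card M"
      by (meson add_le_mono1 card_Un_le le_trans)
    also have "\<dots> \<le> 2 * card ?T + 1"
      using card_image_le[OF \<open>finite ?T\<close>, of "complement q"] M(2) by linarith
    finally show ?thesis .
  qed
  ultimately show ?thesis by linarith
qed

lemma card_universal_qtree: "card (universal_qtree q n) = q\<^sup>2 div 2 * (n choose 2)"
  using card_eq_sum_label_sets[OF universal_subset_qedges]
  by (simp add: label_set_universal card_universal_labels card_index_pairs)

lemma universal_edge_sum:
  assumes x: "x \<in> universal_qtree q n" and ij: "supp x = {i, j}" "i \<noteq> j"
  shows "x i + x j \<le> q + 1" and "x i + x j = q + 1 \<Longrightarrow> i < j \<longleftrightarrow> x i < x j"
proof -
  obtain p l where pl: "p \<in> index_pairs n" "l \<in> labels q" "x = pair_vec p l"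
    using x universal_subset_qedges[of q n] unfolding qedges_eq by auto
  have "l \<in> label_set (universal_qtree q n) q p"
    using x pl by (simp add: label_set_def)
  then have l: "fst l + snd l \<le> q \<or> fst l + snd l = q + 1 \<and> fst l < snd l"
    unfolding label_set_universal[OF pl(1)] by (simp add: universal_labels_def)
  have p: "fst p < snd p" using pl(1) by (auto simp: index_pairs_def)
  have "{fst p, snd p} = {i, j}" using supp_pair_vec[OF pl(1,2)] ij pl(3) by simp
  then have "fst p = i \<and> snd p = j \<or> fst p = j \<and> snd p = i" by (auto simp: doubleton_eq_iff)
  then show "x i + x j \<le> q + 1" "x i + x j = q + 1 \<Longrightarrow> i < j \<longleftrightarrow> x i < x j"
    using l p ij(2) by (auto simp: pl(3) pair_vec_def)
qed

lemma periodic_monotone_constant: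
  fixes a :: "nat \<Rightarrow> nat"
  assumes mono: "\<And>i. a i \<le> a (Suc i)" and per: "\<And>i. a (i + k) = a i" and "k > 0"
  shows "a (Suc i) = a i"
proof -
  have "mono a" using mono by (simp add: mono_iff_le_Suc)
  then have "a (Suc i) \<le> a (i + k)" using \<open>k > 0\<close> by (intro monoD[of a]) auto
  with mono[of i] per show ?thesis by simp
qed

text \<open>Along a cycle, let \<open>a i\<close> and \<open>b i\<close> be the coordinates of the \<open>i\<close>-th edge at its first and second
  vertex. An edge of the universal $q$-tree gives \<open>a i + b i \<le> q + 1\<close>, a turn of the copy gives
  \<open>b i + a (Suc i) \<ge> q + 1\<close>, so \<open>a\<close> is nondecreasing around the cycle and hence constant. Then all
  these inequalities are equalities. For edges with sum \<open>q + 1\<close> the order of the two coordinates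
  is the order of the two indices, so the indices are strictly monotone around the cycle.\<close>
lemma universal_contains_no_copy:
  fixes F :: "'a ugraph"
  assumes F: "simple_graph F" and C: "cycle_of F C"
  shows "\<not> contains_s_copy n q (q + 1) F (universal_qtree q n)"
proof
  assume "contains_s_copy n q (q + 1) F (universal_qtree q n)"
  then obtain H where HU: "H \<subseteq> universal_qtree q n"
    and core: "s_copy_core (q + 1) (induced_subgraph F (non_isolated F)) H"
    unfolding contains_s_copy_def s_copy_iff[OF F] by blast
  define F' where "F' = induced_subgraph F (non_isolated F)"
  have F': "edges F' = edges F" "verts F' = non_isolated F"
    using edges_induced_non_isolated[OF F] by (simp_all add: F'_def) (simp add: induced_subgraph_def)
  have sub: "e \<subseteq> verts F'" "card e = 2" if "e \<in> edges F" for e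
    using F that by (auto simp: F' non_isolated_def simple_graph_def)
  obtain \<iota> where card: "card H = card (edges F)" and iso: "graph_iso \<iota> F' (support_graph H)"
    and ge: "\<forall>e\<in>edges F. \<forall>e'\<in>edges F. e \<noteq> e' \<longrightarrow> (\<forall>v\<in>e \<inter> e'.
      (THE x. x \<in> H \<and> supp x = \<iota> ` e) (\<iota> v) + (THE x. x \<in> H \<and> supp x = \<iota> ` e') (\<iota> v) \<ge> q + 1)"
    using core unfolding s_copy_core_def F'_def[symmetric] F' by (elim conjE exE)
  have inj: "inj_on \<iota> (verts F')" and onto: "\<iota> ` verts F' = (\<Union>x\<in>H. supp x)"
    using iso by (auto simp: graph_iso_def bij_betw_def support_graph_def)
  have adj: "{u, v} \<in> edges F \<longleftrightarrow> {\<iota> u, \<iota> v} \<in> supp ` H" if "u \<in> verts F'" "v \<in> verts F'" for u v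
    using iso that by (auto simp: graph_iso_def support_graph_def F')
  have finH: "finite H"
    using HU universal_subset_qedges finite_qedges finite_subset by metis
  \<comment> \<open>Since \<open>H\<close> and \<open>F\<close> have equally many edges, \<open>supp\<close> is injective on \<open>H\<close>, and the definite
    descriptions in the definition of a copy denote elements of \<open>H\<close>.\<close>
  have "supp ` H = (\<lambda>e. \<iota> ` e) ` edges F"
  proof (intro equalityI subsetI)
    fix d assume d: "d \<in> supp ` H"
    then have "card d = 2" using HU universal_subset_qedges by (force simp: qedges_def)
    then obtain a b where ab: "d = {a, b}" by (auto simp: card_2_iff)
    then have "a \<in> \<iota> ` verts F'" "b \<in> \<iota> ` verts F'" using d unfolding onto by auto
    then obtain u v where uv: "u \<in> verts F'" "v \<in> verts F'" "a = \<iota> u" "b = \<iota> v" by blast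
    then have "{u, v} \<in> edges F" using adj d ab by simp
    then show "d \<in> (\<lambda>e. \<iota> ` e) ` edges F" using ab uv by (intro image_eqI[of _ _ "{u, v}"]) auto
  next
    fix d assume "d \<in> (\<lambda>e. \<iota> ` e) ` edges F"
    then obtain e where e: "e \<in> edges F" "d = \<iota> ` e" by blast
    then obtain u v where "e = {u, v}" using sub(2)[OF e(1)] by (auto simp: card_2_iff)
    moreover from this have "u \<in> verts F'" "v \<in> verts F'" using sub(1)[OF e(1)] by auto
    ultimately show "d \<in> supp ` H" using adj[of u v] e by simp
  qed
  moreover have "inj_on (\<lambda>e. \<iota> ` e) (edges F)"
    using inj_on_image_eq_iff[OF inj] sub(1) by (simp add: inj_on_def)
  ultimately have supp_im: "supp ` H = (\<lambda>e. \<iota> ` e) ` edges F" and "card (supp ` H) = card H"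
    using card by (auto simp: card_image)
  then have inj_supp: "inj_on supp H" using finH by (simp add: eq_card_imp_inj_on)
  define w where "w e = (THE x. x \<in> H \<and> supp x = \<iota> ` e)" for e
  have w: "w e \<in> H" "supp (w e) = \<iota> ` e" if "e \<in> edges F" for e
  proof -
    have "\<exists>!x. x \<in> H \<and> supp x = \<iota> ` e"
    proof (rule ex_ex1I)
      have "\<iota> ` e \<in> supp ` H" unfolding supp_im using that by (rule imageI)
      then show "\<exists>x. x \<in> H \<and> supp x = \<iota> ` e" by (auto simp: image_iff)
      show "x = y" if "x \<in> H \<and> supp x = \<iota> ` e" "y \<in> H \<and> supp y = \<iota> ` e" for x y
        using that by (intro inj_onD[OF inj_supp]) simp_all
    qed
    from theI'[OF this] show "w e \<in> H" "supp (w e) = \<iota> ` e" by (auto simp: w_def)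
  qed
  obtain vs where vs: "distinct vs" "length vs \<ge> 3" and CE: "C \<subseteq> edges F"
    and Ceq: "C = {{vs ! i, vs ! (Suc i mod length vs)} | i. i < length vs}"
    using C by (auto simp: cycle_of_def)
  define k where "k = length vs"
  have k: "k \<ge> 3" "k > 0" using vs by (auto simp: k_def)
  \<comment> \<open>The cycle is unrolled to a periodic sequence, so that monotonicity can be used without wrap-around.\<close>
  define u where "u i = vs ! (i mod k)" for i
  define e where "e i = {u i, u (Suc i)}" for i
  have u_eq: "u i = u j \<longleftrightarrow> i mod k = j mod k" for i j
    unfolding u_def using vs(1) k(2) by (subst nth_eq_iff_index_eq) (auto simp: k_def)
  have eE: "e i \<in> edges F" for i
  proof -
    have "e i = {vs ! (i mod k), vs ! (Suc (i mod k) mod k)}"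
      by (simp add: e_def u_def mod_Suc_eq)
    then have "e i \<in> C" unfolding Ceq k_def[symmetric] using k(2)
      by (intro CollectI exI[of _ "i mod k"]) auto
    then show ?thesis using CE by blast
  qed
  have u_neq: "u i \<noteq> u (Suc i)" for i using sub(2)[OF eE[of i]] by (auto simp: e_def)
  have u_neq2: "u i \<noteq> u (Suc (Suc i))" for i
  proof -
    have "r \<noteq> (r + 2) mod k" if "r < k" for r
    proof (cases "r + 2 < k")
      case False
      then have "(r + 2) mod k = r + 2 - k" using that k(1) by (simp add: mod_if)
      then show ?thesis using False k(1) by linarith
    qed simp
    from this[of "i mod k"] have "i mod k \<noteq> (i + 2) mod k"
      using k(2) unfolding mod_add_left_eq by simp
    then show ?thesis unfolding u_eq by simp
  qed
  have uV: "u i \<in> verts F'" for i using sub(1)[OF eE[of i]] by (simp add: e_def)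
  define p where "p i = \<iota> (u i)" for i
  define a where "a i = w (e i) (p i)" for i
  define b where "b i = w (e i) (p (Suc i))" for i
  have p_neq: "p i \<noteq> p (Suc i)" for i
    unfolding p_def inj_on_eq_iff[OF inj uV uV] by (rule u_neq)
  have supp_w: "supp (w (e i)) = {p i, p (Suc i)}" for i
    using w(2)[OF eE[of i]] by (simp add: e_def p_def)
  have wU: "w (e i) \<in> universal_qtree q n" for i using w(1)[OF eE] HU by blast
  have le: "a i + b i \<le> q + 1"
    and orient: "a i + b i = q + 1 \<Longrightarrow> p i < p (Suc i) \<longleftrightarrow> a i < b i" for i
    using universal_edge_sum[OF wU[of i] supp_w[of i] p_neq[of i]] by (simp_all add: a_def b_def)
  have turn: "b i + a (Suc i) \<ge> q + 1" for i
  proof -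
    have "u i \<notin> e (Suc i)" using u_neq[of i] u_neq2[of i] by (auto simp: e_def)
    then have "e i \<noteq> e (Suc i)" by (auto simp: e_def)
    then show ?thesis
      using bspec[OF mp[OF bspec[OF bspec[OF ge[folded w_def] eE[of i]] eE[of "Suc i"]]], of "u (Suc i)"]
      by (simp add: a_def b_def p_def e_def)
  qed
  have "u (i + k) = u i" for i by (simp add: u_def)
  from this this[of "Suc _"] have "p (i + k) = p i" "a (i + k) = a i" for i
    by (simp_all add: p_def a_def e_def)
  note per = this
  have "a i \<le> a (Suc i)" for i using le[of i] turn[of i] by linarith
  then have const: "a (Suc i) = a i" for i
    using per(2) k(2) by (rule periodic_monotone_constant)
  then have a0: "a i = a 0" for i by (induction i) auto
  have tight: "a i + b i = q + 1" for i
    using le[of i] turn[of i] const[of i] by linarith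
  then have b0: "b i = q + 1 - a 0" for i using a0[of i] by (metis add_diff_cancel_left')
  have dir: "p i < p (Suc i) \<longleftrightarrow> a 0 < q + 1 - a 0" for i
    using orient[OF tight[of i]] a0[of i] b0[of i] by simp
  show False
  proof (cases "a 0 < q + 1 - a 0")
    case True
    then have "strict_mono p" using dir by (simp add: strict_mono_Suc_iff)
    then have "p 0 < p (0 + k)" using k(2) by (simp add: strict_mono_less)
    then show False using per(1)[of 0] by simp
  next
    case False
    then have dec: "p (Suc i) < p i" for i using dir[of i] p_neq[of i] by linarith
    have "p (Suc i) < p 0" for i
      by (induction i) (use dec less_trans in blast)+
    from this[of "k - 1"] show False using per(1)[of 0] k(2) by simp
  qed
qed

section \<open>The extremal number\<close>

text \<open>Pairs with at most \<open>q\<^sup>2 div 2\<close> labels cannot account for the size of \<open>H\<close>, so a positive fraction of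
  all pairs has more labels and therefore a balanced pair among them. Some balanced pair is common
  to a positive fraction of all pairs, and these contain a complete bipartite structure. The pairs
  are kept ordered, \<open>a < b\<close>, so that all of its edges have their first coordinate on the same side.\<close>
lemma dense_qgraph_contains_copy:
  fixes F :: "'a ugraph" and \<delta> :: real
  assumes q: "q \<ge> 1" and F: "simple_graph F" "bipartite F"
    and comp: "\<forall>C\<in>components F. unicyclic C \<or> tree C" and \<delta>: "\<delta> > 0"
  shows "\<exists>N. \<forall>n\<ge>N. \<forall>H. H \<subseteq> qedges n q \<longrightarrow>
    real (card H) \<ge> (real (q\<^sup>2 div 2) + \<delta>) * real (n choose 2) \<longrightarrow> contains_s_copy n q (q + 1) F H"
proof -
  have "finite (edges F)"
    using F(1) by (intro finite_subset[of "edges F" "Pow (verts F)"]) (auto simp: simple_graph_def)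
  moreover have "\<forall>e\<in>edges F. card e = 2" using F(1) by (simp add: simple_graph_def)
  ultimately obtain \<phi> where \<phi>: "inj_on \<phi> (edges F)" "\<forall>e\<in>edges F. \<phi> e \<in> e - {}"
    using charge_edges_injectively[OF _ _ pseudoforest_separated[OF F(1) comp]] by blast
  define K where "K = real (q\<^sup>2 div 2)"
  \<comment> \<open>\<open>q\<^sup>2\<close> bounds the number of labels on a pair, \<open>q ^ 4\<close> is the number of candidates for the
    balanced pair, and \<open>4\<close> comes from \<open>n\<^sup>2 \<le> 4 * (n choose 2)\<close>.\<close>
  define c where "c = \<delta> / (4 * real q ^ 6)"
  have c: "c > 0" using \<delta> q by (simp add: c_def)
  obtain N where N: "\<And>(X::nat set) (Y::nat set) R. finite X \<Longrightarrow> finite Y \<Longrightarrow> card X \<ge> N \<Longrightarrow> card Y \<ge> N \<Longrightarrow>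
    R \<subseteq> X \<times> Y \<Longrightarrow> real (card R) \<ge> c * card X * card Y \<Longrightarrow>
    (\<exists>A B. A \<subseteq> X \<and> B \<subseteq> Y \<and> card A = card (verts F) \<and> card B = card (verts F) \<and> A \<times> B \<subseteq> R)"
    using dense_relation_contains_biclique[OF c, of "card (verts F)"] by metis
  show ?thesis
  proof (intro exI[of _ "max N 2"] allI impI)
    fix n H assume n: "n \<ge> max N 2" and H: "H \<subseteq> qedges n q"
      and "real (card H) \<ge> (real (q\<^sup>2 div 2) + \<delta>) * real (n choose 2)"
    then have "(K + \<delta>) * real (n choose 2) \<le> real (card H)" by (simp add: K_def)
    also have "real (card H) = (\<Sum>p\<in>index_pairs n. real (card (label_set H q p)))"
      by (simp add: card_eq_sum_label_sets[OF H])
    also have "\<dots> \<le> real (q\<^sup>2) * real (card {p \<in> index_pairs n. real (card (label_set H q p)) > K})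
        + K * real (card (index_pairs n))"
    proof (rule sum_le_count_above_threshold)
      show "real (card (label_set H q p)) \<le> real (q\<^sup>2)" for p
        using card_label_set_le[of H q p] by (simp only: of_nat_le_iff)
    qed (simp_all add: K_def)
    finally have rich: "\<delta> * real (n choose 2) \<le> real (q\<^sup>2) * real (card {p \<in> index_pairs n. real (card (label_set H q p)) > K})"
      by (simp add: card_index_pairs algebra_simps)
    define P where "P = {p \<in> index_pairs n. real (card (label_set H q p)) > K}"
    have "\<exists>z. fst z \<in> label_set H q p \<and> snd z \<in> label_set H q p \<and> balanced q (fst z) (snd z)"
      if "p \<in> P" for p
    proof -
      have "card (label_set H q p) > q\<^sup>2 div 2" using that by (simp add: P_def K_def)
      moreover have "label_set H q p \<subseteq> labels q" by (auto simp: label_set_def)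
      ultimately obtain s s' where "s \<in> label_set H q p" "s' \<in> label_set H q p" "balanced q s s'"
        using balanced_labels_exist by blast
      then show ?thesis by (intro exI[of _ "(s, s')"]) simp
    qed
    then obtain g where g: "\<And>p. p \<in> P \<Longrightarrow> fst (g p) \<in> label_set H q p \<and> snd (g p) \<in> label_set H q p
        \<and> balanced q (fst (g p)) (snd (g p))" by metis
    have finP: "finite P" by (simp add: P_def)
    have gim: "g ` P \<subseteq> labels q \<times> labels q"
    proof
      fix z assume "z \<in> g ` P"
      then obtain p where "p \<in> P" "z = g p" by blast
      then show "z \<in> labels q \<times> labels q" using g[of p] by (simp add: mem_Times_iff label_set_def)
    qed
    have "labels q \<times> labels q \<noteq> {}" using q by (auto simp: labels_def)
    then obtain z where z: "card P \<le> card (labels q \<times> labels q) * card {p \<in> P. g p = z}"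
      using pigeonhole_fibre[OF finP _ _ gim] by auto
    define R where "R = {p \<in> P. g p = z}"
    have "card (labels q \<times> labels q) = q ^ 4"
      by (simp add: card_cartesian_product card_labels power_add[symmetric])
    then have "real (card P) \<le> real (q ^ 4 * card R)"
      using z unfolding R_def by (simp only: of_nat_le_iff)
    then have "real (card P) \<le> real q ^ 4 * real (card R)" by simp
    then have "real (q\<^sup>2) * real (card P) \<le> real (q\<^sup>2) * (real q ^ 4 * real (card R))"
      by (intro mult_left_mono) auto
    also have "\<dots> = real q ^ 6 * real (card R)" by (simp add: power_add[symmetric] mult.assoc[symmetric] del: power_Suc)
    finally have "\<delta> * real (n choose 2) \<le> real q ^ 6 * real (card R)"
      using rich unfolding P_def by linarith
    moreover have "real n * real n \<le> 4 * real (n choose 2)"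
    proof -
      have "n * n \<le> 2 * (n * (n - 1))" using n by (cases n) auto
      also have "\<dots> = 4 * (n choose 2)"
      proof -
        have "even (n * (n - 1))" by (cases n) auto
        then have "2 * (n choose 2) = n * (n - 1)"
          unfolding choose_two by (rule dvd_mult_div_cancel)
        then show ?thesis by linarith
      qed
      finally have "real (n * n) \<le> real (4 * (n choose 2))" by (simp only: of_nat_le_iff)
      then show ?thesis by simp
    qed
    then have "\<delta> * (real n * real n) \<le> \<delta> * (4 * real (n choose 2))"
      using \<delta> by (intro mult_left_mono) auto
    ultimately have "\<delta> * (real n * real n) \<le> 4 * real q ^ 6 * real (card R)" by linarith
    then have dens: "c * card {1..n} * card {1..n} \<le> real (card R)"
      using q by (simp add: c_def field_simps)
    have R: "R \<subseteq> {1..n} \<times> {1..n}" by (auto simp: R_def P_def index_pairs_def)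
    obtain A B where AB: "A \<subseteq> {1..n}" "B \<subseteq> {1..n}" "card A = card (verts F)" "card B = card (verts F)"
      "A \<times> B \<subseteq> R"
      using N[OF _ _ _ _ R dens] n by auto
    show "contains_s_copy n q (q + 1) F H"
    proof (cases "R = {}")
      case True
      have "real n > 0" using n by simp
      then have "c * card {1..n} * card {1..n} > 0" using c by simp
      then show ?thesis using dens True by simp
    next
      case False
      then obtain p where "p \<in> P" "g p = z" by (auto simp: R_def)
      then have bal: "balanced q (fst z) (snd z)" using g by blast
      show ?thesis
      proof (rule biclique_contains_copy[OF F \<phi>(1) _ H AB(1-4) _ bal])
        show "\<forall>e\<in>edges F. \<phi> e \<in> e" using \<phi>(2) by simp
        fix a b l assume "a \<in> A" "b \<in> B" "l \<in> {fst z, snd z}"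
        moreover from this have "(a, b) \<in> P" "g (a, b) = z" using AB(5) by (auto simp: R_def)
        ultimately show "(a, b) \<in> index_pairs n \<and> l \<in> label_set H q (a, b)"
          using g[of "(a, b)"] by (auto simp: P_def)
      qed
    qed
  qed
qed

theorem theorem1p6:
  fixes q :: nat and F :: "'a ugraph"
  assumes "q \<ge> 1"
    and "simple_graph F"
    and "bipartite F"
    and "\<forall>C\<in>components F. unicyclic C \<or> tree C"
    and "\<exists>C. cycle_of F C"
  shows "(\<exists>\<epsilon>::nat \<Rightarrow> real. \<epsilon> \<in> o(\<lambda>_. 1) \<and>
            (\<forall>\<^sub>F n in sequentially.
               real (ex n F q) = (of_int \<lfloor>(real q)\<^sup>2 / 2\<rfloor> + \<epsilon> n) * real (n choose 2)))
       \<and> (\<lambda>n. real (ex n F q) - real (card (universal_qtree q n))) \<in> o(\<lambda>n. (real n)\<^sup>2)"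
proof -
  obtain C where C: "cycle_of F C" using assms(5) by blast
  define K where "K = real (q\<^sup>2 div 2)"
  have K: "of_int \<lfloor>(real q)\<^sup>2 / 2\<rfloor> = K"
    using floor_divide_of_nat_eq[of "q\<^sup>2" 2, where ?'a = real] by (simp add: K_def)
  have nonempty: "edges F \<noteq> {}"
  proof
    assume "edges F = {}"
    moreover obtain vs where "length vs \<ge> 3" "C \<subseteq> edges F"
      "C = {{vs ! i, vs ! (Suc i mod length vs)} | i. i < length vs}"
      using C by (auto simp: cycle_of_def)
    ultimately show False by fastforce
  qed
  define \<epsilon> where "\<epsilon> n = real (ex n F q) / real (n choose 2) - K" for n
  have choose_pos: "real (n choose 2) > 0" if "n \<ge> 2" for n
    using that by (simp add: zero_less_binomial)
  have eps: "real (ex n F q) = (K + \<epsilon> n) * real (n choose 2)" if "n \<ge> 2" for n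
    using choose_pos[OF that] by (simp add: \<epsilon>_def)
  have lower: "\<epsilon> n \<ge> 0" if "n \<ge> 2" for n
  proof -
    have "card (universal_qtree q n) \<le> ex n F q"
      by (rule ex_attained(2)[OF assms(2) nonempty universal_subset_qedges
            universal_contains_no_copy[OF assms(2) C]])
    then have "K * real (n choose 2) \<le> real (ex n F q)"
      unfolding card_universal_qtree K_def by (metis of_nat_le_iff of_nat_mult)
    then show ?thesis using choose_pos[OF that] by (simp add: \<epsilon>_def field_simps)
  qed
  have "\<epsilon> \<longlonglongrightarrow> 0"
  proof (rule LIMSEQ_I)
    fix \<delta> :: real assume \<delta>: "\<delta> > 0"
    obtain N where N: "\<And>n H. n \<ge> N \<Longrightarrow> H \<subseteq> qedges n q \<Longrightarrow>
        real (card H) \<ge> (K + \<delta>) * real (n choose 2) \<Longrightarrow> contains_s_copy n q (q + 1) F H"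
      using dense_qgraph_contains_copy[OF assms(1-4) \<delta>] unfolding K_def by blast
    show "\<exists>N. \<forall>n\<ge>N. norm (\<epsilon> n - 0) < \<delta>"
    proof (intro exI[of _ "max N 2"] allI impI)
      fix n assume n: "n \<ge> max N 2"
      obtain H where "H \<subseteq> qedges n q" "\<not> contains_s_copy n q (q + 1) F H" "card H = ex n F q"
        using ex_attained(1)[OF assms(2) nonempty] by blast
      then have "real (ex n F q) < (K + \<delta>) * real (n choose 2)"
        using N[of n H] n by force
      then have "\<epsilon> n < \<delta>" using choose_pos[of n] n by (simp add: \<epsilon>_def field_simps)
      then show "norm (\<epsilon> n - 0) < \<delta>" using lower[of n] n by simp
    qed
  qed
  then have small: "\<epsilon> \<in> o(\<lambda>_. 1)" by (intro smalloI_tendsto) auto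
  have "(\<lambda>n. \<epsilon> n * real (n choose 2)) \<in> o(\<lambda>n. 1 * (real n)\<^sup>2)"
  proof (rule landau_o.small_big_mult[OF small], rule bigoI[of _ 1])
    show "\<forall>\<^sub>F n in sequentially. norm (real (n choose 2)) \<le> 1 * norm ((real n)\<^sup>2)"
      using eventually_ge_at_top[of 2]
    proof eventually_elim
      case (elim n)
      then have "n choose 2 \<le> n ^ 2" by (rule binomial_le_pow)
      then have "real (n choose 2) \<le> real (n ^ 2)" by (simp only: of_nat_le_iff)
      then show ?case by simp
    qed
  qed
  moreover have "\<forall>\<^sub>F n in sequentially.
      \<epsilon> n * real (n choose 2) = real (ex n F q) - real (card (universal_qtree q n))"
    using eventually_ge_at_top[of 2]
    by eventually_elim (simp add: eps card_universal_qtree K_def algebra_simps)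
  ultimately have "(\<lambda>n. real (ex n F q) - real (card (universal_qtree q n))) \<in> o(\<lambda>n. (real n)\<^sup>2)"
    using landau_o.small.in_cong by fastforce
  moreover have "\<forall>\<^sub>F n in sequentially. real (ex n F q) = (of_int \<lfloor>(real q)\<^sup>2 / 2\<rfloor> + \<epsilon> n) * real (n choose 2)"
    unfolding K using eventually_ge_at_top[of 2] by eventually_elim (rule eps)
  ultimately show ?thesis using small by blast
qed

end
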